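(* Let $\Omega\subseteq\mathbb{R}^d$ be open with $\mu(\Omega)<\infty$, let $p(\cdot)\in\mathcal{P}$ with $1<p_-\le p_+<\infty$, and suppose that there exists $x_0\in\Omega$ such that $p(x_0)=p_-$ and $p(\cdot)\in LH_0\{x_0\}$. Let $\varepsilon>0$ be sufficiently small, let $\varkappa$ be a positive monotonically decreasing function on $(0,\varepsilon]$, and let $0<v\le\infty$. Then $$\left(\int_0^\varepsilon\left[\varkappa(t)\,t^{1/p_-}f^*(t)\right]^v\frac{dt}{t}\right)^{1/v}\le c\,\|f\|_{p(\cdot)}$$ holds for some $c>0$ and all $f\in L_{p(\cdot)}(\Omega)$ if, and only if, $\varkappa$ is bounded on $(0,\varepsilon]$ and $p_-\le v\le\infty$, where for $v=\infty$ the inequality is to be read as $$\sup_{0<t<\varepsilon}\varkappa(t)\,t^{1/p_-}f^*(t)\le c\,\|f\|_{p(\cdot)}.\qquad( * )$$ In particular, if $\varkappa$ is an arbitrary non-negative function on $(0,\varepsilon]$, then $( * )$ holds (for some $c>0$ and all $f\in L_{p(\cdot)}(\Omega)$) if, and only if, $\varkappa$ is bounded.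
   Context: $\mu$ is Lebesgue measure on $\Omega$. "Sufficiently small" means $0<\varepsilon\le\varepsilon_0$ for some $\varepsilon_0>0$ depending only on $\Omega$ and $p(\cdot)$. For a measurable $p(\cdot):\Omega\to(0,\infty)$ put $p_-=\operatorname{ess\,inf}_{x\in\Omega}p(x)$, $p_+=\operatorname{ess\,sup}_{x\in\Omega}p(x)$. $\mathcal{P}$ is the set of such functions with $p_->0$ (exponent functions). Log-Hölder continuity: $r(\cdot)\in LH_0\{x_0\}$ (locally log-Hölder continuous at $x_0\in\Omega$) if there is $C_0>0$ with $|r(x)-r(x_0)|\le\frac{C_0}{-\log(|x-x_0|)}$ for all $x\in\Omega$ with $|x-x_0|<1/2$. Variable Lebesgue space $L_{p(\cdot)}(\Omega)$: with $\varrho_{p(\cdot)}(f)=\int_\Omega|f(x)|^{p(x)}\,dx$, it consists of the measurable $f$ with $\varrho_{p(\cdot)}(f/\lambda)<\infty$ for some $\lambda>0$, with quasi-norm $\|f\|_{p(\cdot)}=\inf\{\lambda>0:\varrho_{p(\cdot)}(f/\lambda)\le1\}$. Rearrangement: $f^*(t)=\inf\{s>0:\mu(\{|f|>s\})\le t\}$, $t\ge0$ (with $\inf\emptyset=\infty$). *)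

theory Defs
  imports "HOL-Analysis.Analysis" "HOL-Probability.Essential_Supremum"
begin

text \<open>Functions on \<open>\<Omega>\<close> are total functions on the ambient Euclidean space; only their values
  on \<open>\<Omega>\<close> enter below, because all measure-theoretic notions refer to \<^term>\<open>lebesgue_on \<Omega>\<close>.\<close>

definition essinf :: "'a measure \<Rightarrow> ('a \<Rightarrow> ereal) \<Rightarrow> ereal" where
  "essinf M f = Sup {z. AE x in M. z \<le> f x}"

definition exponent_minus :: "'a::euclidean_space set \<Rightarrow> ('a \<Rightarrow> real) \<Rightarrow> ereal" where
  "exponent_minus \<Omega> p = essinf (lebesgue_on \<Omega>) (\<lambda>x. ereal (p x))"

definition exponent_plus :: "'a::euclidean_space set \<Rightarrow> ('a \<Rightarrow> real) \<Rightarrow> ereal" where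
  "exponent_plus \<Omega> p = esssup (lebesgue_on \<Omega>) (\<lambda>x. ereal (p x))"

definition exponent_functions :: "'a::euclidean_space set \<Rightarrow> ('a \<Rightarrow> real) set" where
  "exponent_functions \<Omega> =
     {p \<in> borel_measurable (lebesgue_on \<Omega>). (\<forall>x\<in>\<Omega>. 0 < p x) \<and> 0 < exponent_minus \<Omega> p}"

text \<open>At \<open>x = x\<^sub>0\<close> the right-hand side is \<open>0\<close> (as \<open>ln 0 = 0\<close> and division by zero gives zero),
  in agreement with the convention \<open>- log 0 = \<infinity>\<close>; the condition is void there.\<close>

definition log_Hoelder_at :: "'a::euclidean_space set \<Rightarrow> 'a \<Rightarrow> ('a \<Rightarrow> real) \<Rightarrow> bool" where
  "log_Hoelder_at \<Omega> x\<^sub>0 r \<longleftrightarrow> x\<^sub>0 \<in> \<Omega> \<and>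
     (\<exists>C\<^sub>0>0. \<forall>x\<in>\<Omega>. norm (x - x\<^sub>0) < 1/2 \<longrightarrow> \<bar>r x - r x\<^sub>0\<bar> \<le> C\<^sub>0 / (- ln (norm (x - x\<^sub>0))))"

definition var_modular ::
    "'a::euclidean_space set \<Rightarrow> ('a \<Rightarrow> real) \<Rightarrow> ('a \<Rightarrow> real) \<Rightarrow> ennreal" where
  "var_modular \<Omega> p f = (\<integral>\<^sup>+x. ennreal (\<bar>f x\<bar> powr p x) \<partial>lebesgue_on \<Omega>)"

definition var_Lebesgue :: "'a::euclidean_space set \<Rightarrow> ('a \<Rightarrow> real) \<Rightarrow> ('a \<Rightarrow> real) set" where
  "var_Lebesgue \<Omega> p =
     {f \<in> borel_measurable (lebesgue_on \<Omega>). \<exists>l>0. var_modular \<Omega> p (\<lambda>x. f x / l) < \<infinity>}"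

definition var_norm :: "'a::euclidean_space set \<Rightarrow> ('a \<Rightarrow> real) \<Rightarrow> ('a \<Rightarrow> real) \<Rightarrow> ennreal" where
  "var_norm \<Omega> p f = (INF l\<in>{l. 0 < l \<and> var_modular \<Omega> p (\<lambda>x. f x / l) \<le> 1}. ennreal l)"

definition rearrangement :: "'a::euclidean_space set \<Rightarrow> ('a \<Rightarrow> real) \<Rightarrow> real \<Rightarrow> ennreal" where
  "rearrangement \<Omega> f t =
     (INF s\<in>{s. 0 < s \<and> emeasure (lebesgue_on \<Omega>) {x \<in> \<Omega>. s < \<bar>f x\<bar>} \<le> ennreal t}. ennreal s)"

text \<open>Extended non-negative powers, used for exponents \<open>a > 0\<close> only.\<close>

definition ennreal_powr :: "ennreal \<Rightarrow> real \<Rightarrow> ennreal" where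
  "ennreal_powr y a = (if y = \<infinity> then \<infinity> else ennreal (enn2real y powr a))"

definition weighted_rearrangement ::
    "'a::euclidean_space set \<Rightarrow> ('a \<Rightarrow> real) \<Rightarrow> (real \<Rightarrow> real) \<Rightarrow> ('a \<Rightarrow> real) \<Rightarrow> real \<Rightarrow> ennreal" where
  "weighted_rearrangement \<Omega> p \<kappa> f t =
     ennreal (\<kappa> t) * ennreal (t powr (1 / real_of_ereal (exponent_minus \<Omega> p))) * rearrangement \<Omega> f t"

definition rearrangement_functional ::
    "'a::euclidean_space set \<Rightarrow> ('a \<Rightarrow> real) \<Rightarrow> (real \<Rightarrow> real) \<Rightarrow> real \<Rightarrow> ereal \<Rightarrow> ('a \<Rightarrow> real) \<Rightarrow> ennreal" where
  "rearrangement_functional \<Omega> p \<kappa> \<epsilon> v f =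
     (if v = \<infinity> then SUP t\<in>{0<..<\<epsilon>}. weighted_rearrangement \<Omega> p \<kappa> f t
      else ennreal_powr
        (\<integral>\<^sup>+t\<in>{0<..<\<epsilon>}.
           (ennreal_powr (weighted_rearrangement \<Omega> p \<kappa> f t) (real_of_ereal v) / ennreal t) \<partial>lborel)
        (1 / real_of_ereal v))"

definition rearrangement_inequality ::
    "'a::euclidean_space set \<Rightarrow> ('a \<Rightarrow> real) \<Rightarrow> (real \<Rightarrow> real) \<Rightarrow> real \<Rightarrow> ereal \<Rightarrow> bool" where
  "rearrangement_inequality \<Omega> p \<kappa> \<epsilon> v \<longleftrightarrow>
     (\<exists>c::real. 0 < c \<and> (\<forall>f\<in>var_Lebesgue \<Omega> p.
        rearrangement_functional \<Omega> p \<kappa> \<epsilon> v f \<le> ennreal c * var_norm \<Omega> p f))"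

end

theory Submission
  imports Defs
begin

text \<open>Write \<open>q = p\<^sub>-\<close>. Since \<open>\<mu>(\<Omega>) < \<infinity>\<close> and \<open>q \<le> p\<close> almost everywhere, \<open>L\<^bsub>p(\<cdot>)\<^esub>\<close> embeds
  into \<open>L\<^bsub>q\<^esub>\<close>; there \<open>t\<^bsup>1/q\<^esup> f\<^sup>*(t)\<close> is bounded by the norm and \<open>f\<^sup>* \<in> L\<^bsub>q\<^esub>(0, \<infinity>)\<close>, and writing
  \<open>(t\<^bsup>1/q\<^esup> f\<^sup>*)\<^bsup>v\<^esup>/t = (t\<^bsup>1/q\<^esup> f\<^sup>*)\<^bsup>v-q\<^esup> (f\<^sup>*)\<^bsup>q\<^esup>\<close> gives all \<open>v \<ge> q\<close>.

  Conversely, log-Hoelder continuity at \<open>x\<^sub>0\<close> keeps \<open>r\<^bsup>-(p(x)-q)\<^esup>\<close> bounded on the ball of radius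
  \<open>r\<close> about \<open>x\<^sub>0\<close>, so indicators of small balls \<open>B\<close> have norm at most \<open>K \<mu>(B)\<^bsup>1/q\<^esup>\<close>. If \<open>B\<^sub>k\<close> is the
  ball of measure \<open>m 2\<^bsup>-k\<^esup>\<close>, the maximum of the functions \<open>2\<^bsup>k/q\<^esup> \<chi>\<^bsub>B\<^sub>k\<^esub>\<close> over \<open>k < N\<close> has norm at most
  \<open>K m\<^bsup>1/q\<^esup> N\<^bsup>1/q\<^esup>\<close>, whereas each of the \<open>N\<close> dyadic intervals contributes the same amount to the
  left-hand side, so \<open>\<kappa>(m) N\<^bsup>1/v\<^esup> \<le> c' N\<^bsup>1/q\<^esup>\<close>. Taking \<open>N = 1\<close> bounds \<open>\<kappa>\<close>, and \<open>N \<rightarrow> \<infinity>\<close> forces \<open>v \<ge> q\<close>.\<close>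

section \<open>Preliminaries: essential infimum, extended powers, layer-cake formula\<close>

lemma AE_essinf_le: "AE x in M. essinf M f \<le> f x"
proof -
  let ?S = "{z. AE x in M. z \<le> f x}"
  have "bot \<in> ?S" by auto
  then have "?S \<noteq> {}" by blast
  \<comment> \<open>The defining supremum may run over uncountably many lower bounds, each with its
    own null set. A sequence with the same supremum leaves only countably many null sets to
    unite.\<close>
  then obtain z :: "nat \<Rightarrow> ereal" where z: "range z \<subseteq> ?S" "essinf M f = (SUP i. z i)"
    unfolding essinf_def by (metis Sup_countable_SUP)
  have "AE x in M. \<forall>i. z i \<le> f x"
    using z(1) by (subst AE_all_countable) auto
  then show ?thesis
    by eventually_elim (simp add: z(2) SUP_le_iff)
qed

lemma ennreal_powr_ennreal [simp]: "0 \<le> x \<Longrightarrow> ennreal_powr (ennreal x) a = ennreal (x powr a)"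
  by (simp add: ennreal_powr_def)

lemma ennreal_powr_mono:
  assumes "x \<le> y" "0 \<le> a"
  shows "ennreal_powr x a \<le> ennreal_powr y a"
proof (cases "y = \<infinity>")
  case False
  then have "x \<noteq> \<infinity>" using assms(1) by (auto simp: top_unique)
  with False assms show ?thesis
    by (cases x; cases y) (auto simp: ennreal_powr_def intro!: ennreal_leI powr_mono2)
qed (simp add: ennreal_powr_def)

text \<open>This translates superlevel sets of a q-th power into superlevel sets of its base, for
  bases that may be infinite, so that the distributions of f and of its rearrangement can be
  compared level by level.\<close>

lemma ennreal_less_ennreal_powr_iff:
  assumes "0 < s" "0 < q"
  shows "ennreal s < ennreal_powr y q \<longleftrightarrow> ennreal (s powr (1 / q)) < y"
proof (cases y)
  case (real r)
  have "s < r powr q \<longleftrightarrow> s powr (1 / q) < r"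
  proof
    assume "s < r powr q"
    then have "s powr (1 / q) < (r powr q) powr (1 / q)"
      using assms by (intro powr_less_mono2) auto
    then show "s powr (1 / q) < r" using real assms by (simp add: powr_powr)
  next
    assume "s powr (1 / q) < r"
    then have "(s powr (1 / q)) powr q < r powr q"
      using assms by (intro powr_less_mono2) auto
    then show "s < r powr q" using assms by (simp add: powr_powr)
  qed
  with real assms show ?thesis by (simp add: ennreal_less_iff)
qed (use assms in \<open>simp add: ennreal_powr_def\<close>)

text \<open>Superlevel sets of a decreasing function are intervals. Measurability of the
  rearrangement and of its powers is obtained in this way.\<close>

lemma antimono_ennreal_borel_measurable:
  fixes F :: "real \<Rightarrow> ennreal"
  assumes "antimono F"
  shows "F \<in> borel_measurable borel"
proof (rule borel_measurableI_greater)
  fix y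
  have "is_interval {t. y < F t}"
    unfolding is_interval_1 using assms by (auto dest: antimonoD intro: less_le_trans)
  then show "{t \<in> space borel. y < F t} \<in> sets borel"
    using real_interval_borel_measurable by simp
qed

text \<open>Tonelli for the region under the graph: integrating its indicator in \<open>s\<close>
  first gives \<open>F x\<close>, also where this is infinite, and integrating in \<open>x\<close>
  first gives the measures of the superlevel sets.\<close>

lemma nn_integral_layer_cake:
  fixes F :: "'a \<Rightarrow> ennreal"
  assumes "sigma_finite_measure M" and F [measurable]: "F \<in> borel_measurable M"
  shows "(\<integral>\<^sup>+x. F x \<partial>M) =
    (\<integral>\<^sup>+s. emeasure M {x \<in> space M. ennreal s < F x} * indicator {0<..} s \<partial>lborel)"
proof -
  interpret pair_sigma_finite M lborel
    using assms(1) sigma_finite_lborel by (rule pair_sigma_finite.intro)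
  define I where "I s x = (indicator {s. 0 < s \<and> ennreal s < F x} s :: ennreal)" for s x
  have [measurable]: "(\<lambda>(s, x). I s x) \<in> borel_measurable (lborel \<Otimes>\<^sub>M M)"
  proof -
    have *: "{z \<in> space (lborel \<Otimes>\<^sub>M M). 0 < fst z \<and> ennreal (fst z) < F (snd z)}
       \<in> sets (lborel \<Otimes>\<^sub>M M)" by measurable
    show ?thesis
      by (rule measurable_cong[THEN iffD1, OF _ borel_measurable_indicator[OF *]])
        (auto simp: I_def indicator_def space_pair_measure)
  qed
  have [measurable]: "(\<lambda>(x, s). I s x) \<in> borel_measurable (M \<Otimes>\<^sub>M lborel)"
    by measurable
  have "F x = (\<integral>\<^sup>+s. I s x \<partial>lborel)" for x
  proof (cases "F x")
    case (real a)
    have "{s. 0 < s \<and> ennreal s < F x} = {0<..<a}"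
      using real by (auto simp: ennreal_less_iff)
    then show ?thesis using real by (simp add: I_def)
  next
    case top
    then have "{s. 0 < s \<and> ennreal s < F x} = {0<..}" by auto
    moreover have "emeasure lborel {0::real<..} = \<infinity>"
    proof (cases "emeasure lborel {0::real<..}")
      case (real a)
      \<comment> \<open>If the half-line had finite measure \<open>a\<close>, its subset (0, a + 1]
        of measure a + 1 would be too large.\<close>
      have "emeasure lborel {0<..a + 1} \<le> emeasure lborel {0::real<..}"
        by (rule emeasure_mono) auto
      then show ?thesis using real by simp
    qed simp
    ultimately show ?thesis using top by (simp add: I_def)
  qed
  then have "(\<integral>\<^sup>+x. F x \<partial>M) = (\<integral>\<^sup>+x. (\<integral>\<^sup>+s. I s x \<partial>lborel) \<partial>M)" by simp
  also have "\<dots> = (\<integral>\<^sup>+s. (\<integral>\<^sup>+x. I s x \<partial>M) \<partial>lborel)"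
    by (rule Fubini'[where f = "\<lambda>x s. I s x", symmetric]) measurable
  also have "\<dots> = (\<integral>\<^sup>+s. emeasure M {x \<in> space M. ennreal s < F x} * indicator {0<..} s \<partial>lborel)"
  proof (rule nn_integral_cong)
    fix s :: real
    have "(\<integral>\<^sup>+x. I s x \<partial>M) =
        (\<integral>\<^sup>+x. indicator {0<..} s * indicator {x \<in> space M. ennreal s < F x} x \<partial>M)"
      by (rule nn_integral_cong) (auto simp: I_def indicator_def)
    also have "\<dots> = indicator {0<..} s * emeasure M {x \<in> space M. ennreal s < F x}"
      by (rule nn_integral_cmult_indicator) measurable
    finally show "(\<integral>\<^sup>+x. I s x \<partial>M) =
        emeasure M {x \<in> space M. ennreal s < F x} * indicator {0<..} s"
      by (simp add: mult.commute)
  qed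
  finally show ?thesis .
qed

section \<open>The decreasing rearrangement\<close>

lemma rearrangement_le:
  assumes "0 < s" "emeasure (lebesgue_on \<Omega>) {x \<in> \<Omega>. s < \<bar>f x\<bar>} \<le> ennreal t"
  shows "rearrangement \<Omega> f t \<le> ennreal s"
  unfolding rearrangement_def using assms by (intro INF_lower) auto

lemma less_rearrangementD:
  assumes "0 < s" "ennreal s < rearrangement \<Omega> f t"
  shows "ennreal t < emeasure (lebesgue_on \<Omega>) {x \<in> \<Omega>. s < \<bar>f x\<bar>}"
  using assms rearrangement_le[of s \<Omega> f t] by (meson not_le)

lemma rearrangement_antimono:
  assumes "t \<le> u" shows "rearrangement \<Omega> f u \<le> rearrangement \<Omega> f t"
  unfolding rearrangement_def
  by (intro INF_superset_mono) (auto intro: order_trans ennreal_leI[OF assms])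

text \<open>A level s < a is not admissible in the infimum: the set where |f| > s contains
  \<open>B\<close> and so has measure greater than \<open>t\<close>. This is the source of the lower
  bounds for the test functions.\<close>

lemma le_rearrangement:
  assumes "B \<in> sets (lebesgue_on \<Omega>)" "\<And>x. x \<in> B \<Longrightarrow> a \<le> \<bar>f x\<bar>"
    and "ennreal t < emeasure (lebesgue_on \<Omega>) B" and f: "f \<in> borel_measurable (lebesgue_on \<Omega>)"
  shows "ennreal a \<le> rearrangement \<Omega> f t"
  unfolding rearrangement_def
proof (rule INF_greatest, clarify)
  fix s :: real
  assume s: "0 < s" "emeasure (lebesgue_on \<Omega>) {x \<in> \<Omega>. s < \<bar>f x\<bar>} \<le> ennreal t"
  have "{x \<in> space (lebesgue_on \<Omega>). s < \<bar>f x\<bar>} \<in> sets (lebesgue_on \<Omega>)"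
    using f by measurable
  then have meas: "{x \<in> \<Omega>. s < \<bar>f x\<bar>} \<in> sets (lebesgue_on \<Omega>)" by simp
  have "\<not> s < a"
  proof
    assume "s < a"
    then have "B \<subseteq> {x \<in> \<Omega>. s < \<bar>f x\<bar>}"
      using assms(2) sets.sets_into_space[OF assms(1)] by force
    then have "emeasure (lebesgue_on \<Omega>) B \<le> ennreal t"
      using emeasure_mono[OF _ meas] s(2) by (meson order_trans)
    then show False using assms(3) by simp
  qed
  then show "ennreal a \<le> ennreal s" by (intro ennreal_leI) simp
qed

text \<open>Both sides are expanded by the layer-cake formula and compared at each level. If m is
  the measure of the set where |f| exceeds a level, then the rearrangement can exceed that level on
  (0, \<infinity>) only at points t < m, hence on a set of measure at most m.\<close>

lemma nn_integral_rearrangement_powr_le: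
  assumes \<Omega>: "\<Omega> \<in> lmeasurable" and f [measurable]: "f \<in> borel_measurable (lebesgue_on \<Omega>)" and q: "0 < q"
  shows "(\<integral>\<^sup>+t\<in>{0<..}. ennreal_powr (rearrangement \<Omega> f t) q \<partial>lborel)
    \<le> (\<integral>\<^sup>+x. ennreal (\<bar>f x\<bar> powr q) \<partial>lebesgue_on \<Omega>)" (is "?L \<le> ?R")
proof -
  let ?F = "\<lambda>t. ennreal_powr (rearrangement \<Omega> f t) q"
  have "antimono ?F"
    using q by (auto intro!: antimonoI ennreal_powr_mono rearrangement_antimono)
  then have [measurable]: "?F \<in> borel_measurable borel"
    by (rule antimono_ennreal_borel_measurable)
  have sf: "sigma_finite_measure (lebesgue_on \<Omega>)"
    using finite_measure_lebesgue_on[OF \<Omega>] by (simp add: finite_measure_def)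
  have "?L = (\<integral>\<^sup>+s. emeasure lborel {t. ennreal s < ?F t * indicator {0<..} t} * indicator {0<..} s \<partial>lborel)"
    by (subst nn_integral_layer_cake[OF sigma_finite_lborel]) simp_all
  also have "\<dots> \<le> (\<integral>\<^sup>+s. emeasure (lebesgue_on \<Omega>) {x \<in> space (lebesgue_on \<Omega>).
      ennreal s < ennreal (\<bar>f x\<bar> powr q)} * indicator {0<..} s \<partial>lborel)"
  proof (rule nn_integral_mono)
    fix s :: real
    show "emeasure lborel {t. ennreal s < ?F t * indicator {0<..} t} * indicator {0<..} s \<le>
      emeasure (lebesgue_on \<Omega>) {x \<in> space (lebesgue_on \<Omega>). ennreal s < ennreal (\<bar>f x\<bar> powr q)}
        * indicator {0<..} s"
    proof (cases "0 < s")
      case True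
      let ?r = "s powr (1 / q)"
      let ?m = "emeasure (lebesgue_on \<Omega>) {x \<in> \<Omega>. ?r < \<bar>f x\<bar>}"
      have eq: "{x \<in> space (lebesgue_on \<Omega>). ennreal s < ennreal (\<bar>f x\<bar> powr q)} = {x \<in> \<Omega>. ?r < \<bar>f x\<bar>}"
        using ennreal_less_ennreal_powr_iff[OF True q, of "ennreal \<bar>f x\<bar>" for x]
        by (auto simp: ennreal_less_iff)
      have sub: "{t. ennreal s < ?F t * indicator {0<..} t} \<subseteq> {t. 0 < t \<and> ennreal t < ?m}"
        using True less_rearrangementD[of ?r \<Omega> f]
        by (auto simp: ennreal_less_ennreal_powr_iff[OF True q] indicator_def split: if_splits)
      have "emeasure lborel {t. ennreal s < ?F t * indicator {0<..} t} \<le> ?m"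
      proof (cases ?m)
        case (real a)
        then have "{t. 0 < t \<and> ennreal t < ?m} = {0<..<a}"
          by (auto simp: ennreal_less_iff)
        then have "emeasure lborel {t. ennreal s < ?F t * indicator {0<..} t} \<le> emeasure lborel {0<..<a}"
          using sub by (intro emeasure_mono) auto
        then show ?thesis using real by simp
      qed simp
      with True show ?thesis by (simp only: eq) (simp add: mult_right_mono)
    qed simp
  qed
  also have "\<dots> = ?R"
    by (rule nn_integral_layer_cake[OF sf, symmetric]) measurable
  finally show ?thesis .
qed

text \<open>Chebyshev's inequality: for s = (A/t)^(1/q) the set where |f| > s has measure at most A
  / s^q = t, so s is admissible in the infimum defining the rearrangement.\<close>

lemma rearrangement_weak_type:
  assumes f [measurable]: "f \<in> borel_measurable (lebesgue_on \<Omega>)" and q: "0 < q"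
    and A: "(\<integral>\<^sup>+x. ennreal (\<bar>f x\<bar> powr q) \<partial>lebesgue_on \<Omega>) \<le> ennreal A" and "0 < A" "0 < t"
  shows "rearrangement \<Omega> f t \<le> ennreal ((A / t) powr (1 / q))"
proof (rule rearrangement_le)
  let ?s = "(A / t) powr (1 / q)"
  show "0 < ?s" using assms by simp
  have "{x \<in> \<Omega>. ?s < \<bar>f x\<bar>} \<subseteq> {x \<in> space (lebesgue_on \<Omega>). 1 \<le> ennreal (t / A) * ennreal (\<bar>f x\<bar> powr q)}"
  proof clarsimp
    fix x assume "?s < \<bar>f x\<bar>"
    then have "?s powr q < \<bar>f x\<bar> powr q"
      using q assms(4,5) by (intro powr_less_mono2) auto
    then have "1 \<le> t / A * \<bar>f x\<bar> powr q"
      using q assms(4,5) by (simp add: powr_powr field_simps)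
    then show "1 \<le> ennreal (t / A) * ennreal (\<bar>f x\<bar> powr q)"
      using assms(4,5) by (simp flip: ennreal_mult' ennreal_1 add: ennreal_leI del: ennreal_1)
  qed
  then have "emeasure (lebesgue_on \<Omega>) {x \<in> \<Omega>. ?s < \<bar>f x\<bar>} \<le>
      emeasure (lebesgue_on \<Omega>) {x \<in> space (lebesgue_on \<Omega>). 1 \<le> ennreal (t / A) * ennreal (\<bar>f x\<bar> powr q)}"
    by (rule emeasure_mono) measurable
  also have "\<dots> \<le> ennreal (t / A) * (\<integral>\<^sup>+x. ennreal (\<bar>f x\<bar> powr q) * indicator (space (lebesgue_on \<Omega>)) x \<partial>lebesgue_on \<Omega>)"
    by (intro nn_integral_Markov_inequality borel_measurable_times_ennreal borel_measurable_indicator sets.top)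
      measurable
  also have "\<dots> \<le> ennreal (t / A) * ennreal A"
    using A by (intro mult_left_mono) (auto simp: nn_integral_set_ennreal[symmetric] cong: nn_integral_cong_simp)
  also have "\<dots> = ennreal t" using assms(4,5) by (simp flip: ennreal_mult')
  finally show "emeasure (lebesgue_on \<Omega>) {x \<in> \<Omega>. ?s < \<bar>f x\<bar>} \<le> ennreal t" .
qed

section \<open>Embedding into L_q and sufficiency\<close>

text \<open>For y = |f x| / l one has y^q \<le> y^(p x) + 1: the summand 1 covers y \<le> 1, and for
  y > 1 the exponents are compared. Integrating the summand 1 produces the measure of
  \<Omega>.\<close>

lemma nn_integral_powr_le_modular:
  assumes \<Omega>: "\<Omega> \<in> sets lebesgue"
    and AEp: "AE x in lebesgue_on \<Omega>. q \<le> p x" and q: "0 < q"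
    and p [measurable]: "p \<in> borel_measurable (lebesgue_on \<Omega>)"
    and f [measurable]: "f \<in> borel_measurable (lebesgue_on \<Omega>)" and l: "0 < l" "var_modular \<Omega> p (\<lambda>x. f x / l) \<le> 1"
  shows "(\<integral>\<^sup>+x. ennreal (\<bar>f x\<bar> powr q) \<partial>lebesgue_on \<Omega>) \<le> ennreal (l powr q) * (1 + emeasure lebesgue \<Omega>)"
proof -
  have "(\<integral>\<^sup>+x. ennreal (\<bar>f x\<bar> powr q) \<partial>lebesgue_on \<Omega>) \<le>
     (\<integral>\<^sup>+x. ennreal (l powr q) * (ennreal (\<bar>f x / l\<bar> powr p x) + 1) \<partial>lebesgue_on \<Omega>)"
  proof (rule nn_integral_mono_AE, use AEp in eventually_elim)
    fix x assume "q \<le> p x"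
    have "\<bar>f x\<bar> powr q = l powr q * \<bar>f x / l\<bar> powr q"
      using l by (simp add: abs_divide powr_divide)
    moreover have "\<bar>f x / l\<bar> powr q \<le> \<bar>f x / l\<bar> powr p x + 1"
    proof (cases "\<bar>f x / l\<bar> \<le> 1")
      case True
      then have "\<bar>f x / l\<bar> powr q \<le> 1" using q by (intro powr_le1) auto
      then show ?thesis by (simp add: add_increasing)
    next
      case False
      then have "\<bar>f x / l\<bar> powr q \<le> \<bar>f x / l\<bar> powr p x" using \<open>q \<le> p x\<close> by (intro powr_mono) auto
      then show ?thesis by simp
    qed
    ultimately have "\<bar>f x\<bar> powr q \<le> l powr q * (\<bar>f x / l\<bar> powr p x + 1)"
      by (simp add: mult_left_mono)
    then have "ennreal (\<bar>f x\<bar> powr q) \<le> ennreal (l powr q * (\<bar>f x / l\<bar> powr p x + 1))"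
      by (rule ennreal_leI)
    then show "ennreal (\<bar>f x\<bar> powr q) \<le> ennreal (l powr q) * (ennreal (\<bar>f x / l\<bar> powr p x) + 1)"
      by (simp add: ennreal_mult')
  qed
  also have "\<dots> = ennreal (l powr q) * (var_modular \<Omega> p (\<lambda>x. f x / l) + emeasure lebesgue \<Omega>)"
    unfolding var_modular_def using \<Omega>
    by (subst nn_integral_cmult) (auto simp: nn_integral_add emeasure_restrict_space)
  also have "\<dots> \<le> ennreal (l powr q) * (1 + emeasure lebesgue \<Omega>)"
    using l by (intro mult_left_mono add_right_mono) auto
  finally show ?thesis .
qed

text \<open>The norm is an infimum over admissible \<open>l\<close>, so an upper bound by a multiple
  of it may be checked at each such \<open>l\<close> separately. If there is none, the norm is
  infinite.\<close>

lemma le_mult_var_normI: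
  assumes "0 < c" "\<And>l. 0 < l \<Longrightarrow> var_modular \<Omega> p (\<lambda>x. f x / l) \<le> 1 \<Longrightarrow> a \<le> ennreal c * ennreal l"
  shows "a \<le> ennreal c * var_norm \<Omega> p f"
proof -
  have "a / ennreal c \<le> var_norm \<Omega> p f"
    unfolding var_norm_def
    by (rule INF_greatest) (use assms in \<open>auto intro!: divide_le_posI_ennreal\<close>)
  then have "ennreal c * (a / ennreal c) \<le> ennreal c * var_norm \<Omega> p f"
    by (intro mult_left_mono) auto
  moreover have "ennreal c * (a / ennreal c) = a"
    using assms(1) by (simp add: ennreal_times_divide mult.commute mult_divide_eq_ennreal)
  ultimately show ?thesis by simp
qed

lemma rearrangement_inequality_if_bounded:
  assumes \<Omega>: "\<Omega> \<in> lmeasurable" and p: "p \<in> borel_measurable (lebesgue_on \<Omega>)"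
    and q: "exponent_minus \<Omega> p = ereal q" "0 < q" and v: "ereal q \<le> v"
    and b: "0 < b" "\<And>t. t \<in> {0<..<\<epsilon>} \<Longrightarrow> \<kappa> t \<le> b"
  shows "rearrangement_inequality \<Omega> p \<kappa> \<epsilon> v"
proof -
  let ?\<mu> = "measure lebesgue \<Omega>"
  \<comment> \<open>The factor \<open>b\<close> bounds \<open>\<kappa>\<close> and the other factor
    is the embedding constant. The same constant serves every v \<ge> q.\<close>
  let ?c = "b * (1 + ?\<mu>) powr (1 / q)"
  have AEq: "AE x in lebesgue_on \<Omega>. q \<le> p x"
    using AE_essinf_le[of "lebesgue_on \<Omega>" "\<lambda>x. ereal (p x)"] q(1) unfolding exponent_minus_def by simp
  have "0 < 1 + ?\<mu>" by (simp add: add_pos_nonneg)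
  then have c: "0 < ?c" using b(1) by simp
  have "rearrangement_functional \<Omega> p \<kappa> \<epsilon> v f \<le> ennreal ?c * var_norm \<Omega> p f"
    if "f \<in> var_Lebesgue \<Omega> p" for f
  proof (rule le_mult_var_normI[OF c])
    fix l :: real
    assume l: "0 < l" "var_modular \<Omega> p (\<lambda>x. f x / l) \<le> 1"
    have f: "f \<in> borel_measurable (lebesgue_on \<Omega>)" using that by (simp add: var_Lebesgue_def)
    define A where "A = l powr q * (1 + ?\<mu>)"
    have "0 < 1 + ?\<mu>" by (simp add: add_pos_nonneg)
    then have A: "0 < A" using l by (simp add: A_def)
    have Aq: "A powr (1 / q) = l * (1 + ?\<mu>) powr (1 / q)"
      using l q(2) by (simp add: A_def powr_mult powr_powr)
    have intA: "(\<integral>\<^sup>+x. ennreal (\<bar>f x\<bar> powr q) \<partial>lebesgue_on \<Omega>) \<le> ennreal A"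
    proof -
      have "1 + emeasure lebesgue \<Omega> = ennreal (1 + ?\<mu>)"
        using \<Omega> by (simp add: emeasure_eq_measure2)
      then show ?thesis
        using nn_integral_powr_le_modular[OF _ AEq q(2) p f l] \<Omega> l
        by (simp add: A_def ennreal_mult' fmeasurableD)
    qed
    \<comment> \<open>The weak-type bound makes the rearrangement finite at every t > 0, so its
      value can be named by a real \<open>h\<close> and the estimates can be carried out in the
      reals.\<close>
    have weak: "\<exists>h\<ge>0. rearrangement \<Omega> f t = ennreal h \<and> t powr (1 / q) * h \<le> A powr (1 / q)"
      if "0 < t" for t
    proof -
      have le: "rearrangement \<Omega> f t \<le> ennreal ((A / t) powr (1 / q))"
        by (rule rearrangement_weak_type[OF f q(2) intA A that])
      then obtain h where h: "0 \<le> h" "rearrangement \<Omega> f t = ennreal h"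
        by (cases "rearrangement \<Omega> f t") (auto simp: top_unique)
      with le have "h \<le> (A / t) powr (1 / q)" by simp
      then have "t powr (1 / q) * h \<le> t powr (1 / q) * (A / t) powr (1 / q)"
        by (rule mult_left_mono) simp
      also have "\<dots> = A powr (1 / q)" using that A by (simp add: powr_divide)
      finally show ?thesis using h by blast
    qed
    have weighted: "weighted_rearrangement \<Omega> p \<kappa> f t \<le> ennreal (b * (t powr (1 / q) * h))"
      if "t \<in> {0<..<\<epsilon>}" "0 \<le> h" "rearrangement \<Omega> f t = ennreal h" for t h
    proof -
      have "weighted_rearrangement \<Omega> p \<kappa> f t \<le> ennreal b * ennreal (t powr (1 / q)) * ennreal h"
        unfolding weighted_rearrangement_def using b(2)[OF that(1)] that q(1)
        by (auto intro!: mult_right_mono ennreal_leI)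
      also have "\<dots> = ennreal (b * (t powr (1 / q) * h))"
        using b(1) that by (simp add: ennreal_mult' mult.assoc)
      finally show ?thesis .
    qed
    have "rearrangement_functional \<Omega> p \<kappa> \<epsilon> v f \<le> ennreal (b * A powr (1 / q))"
    proof (cases "v = \<infinity>")
      case True
      have "weighted_rearrangement \<Omega> p \<kappa> f t \<le> ennreal (b * A powr (1 / q))"
        if t: "t \<in> {0<..<\<epsilon>}" for t
      proof -
        obtain h where h: "0 \<le> h" "rearrangement \<Omega> f t = ennreal h" "t powr (1 / q) * h \<le> A powr (1 / q)"
          using weak[of t] t by auto
        show ?thesis
          using weighted[OF t h(1,2)] h(3) b(1)
          by (auto elim!: order_trans intro!: ennreal_leI mult_left_mono)
      qed
      then show ?thesis
        unfolding rearrangement_functional_def using True by (auto intro!: SUP_least)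
    next
      case False
      then obtain r where r: "v = ereal r" "q \<le> r" using v by (cases v) auto
      \<comment> \<open>Of the r factors t^(1/q) h, the exponent r - q is estimated by the weak-type
        bound A^(1/q). \<open>D\<close> collects this estimate and b^r from \<open>\<kappa>\<close>;
        the remaining exponent q is kept for the integral.\<close>
      define D where "D = b powr r * (A powr (1 / q)) powr (r - q)"
      have "0 \<le> D" by (simp add: D_def)
      have meas: "(\<lambda>t. ennreal_powr (rearrangement \<Omega> f t) q) \<in> borel_measurable borel"
        using q(2) by (auto intro!: antimono_ennreal_borel_measurable antimonoI ennreal_powr_mono rearrangement_antimono)
      have point: "ennreal_powr (weighted_rearrangement \<Omega> p \<kappa> f t) r / ennreal t
          \<le> ennreal D * ennreal_powr (rearrangement \<Omega> f t) q" if t: "t \<in> {0<..<\<epsilon>}" for t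
      proof -
        obtain h where h: "0 \<le> h" "rearrangement \<Omega> f t = ennreal h" "t powr (1 / q) * h \<le> A powr (1 / q)"
          using weak[of t] t by auto
        let ?w = "t powr (1 / q) * h"
        have "0 < t" using t by simp
        have "?w powr r = ?w powr (r - q) * ?w powr q" by (simp flip: powr_add)
        moreover have "(b * ?w) powr r = b powr r * ?w powr r"
          by (rule powr_mult)
        ultimately have "(b * ?w) powr r / t = b powr r * (?w powr (r - q) * ?w powr q) / t"
          by metis
        \<comment> \<open>The factor t from (t^(1/q) h)^q cancels the weight 1/t.\<close>
        also have "\<dots> = b powr r * ?w powr (r - q) * h powr q"
          using \<open>0 < t\<close> q(2) h(1) by (simp add: powr_mult powr_powr)
        also have "\<dots> \<le> D * h powr q"
          unfolding D_def using h r by (intro mult_right_mono mult_left_mono powr_mono2) auto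
        finally have *: "(b * ?w) powr r / t \<le> D * h powr q" .
        have "ennreal_powr (weighted_rearrangement \<Omega> p \<kappa> f t) r / ennreal t
            \<le> ennreal_powr (ennreal (b * ?w)) r / ennreal t"
          using weighted[OF t h(1,2)] q(2) r by (intro divide_right_mono_ennreal ennreal_powr_mono) auto
        also have "\<dots> = ennreal ((b * ?w) powr r / t)"
          using b(1) h(1) \<open>0 < t\<close> by (simp add: divide_ennreal)
        also have "\<dots> \<le> ennreal (D * h powr q)" by (rule ennreal_leI[OF *])
        finally show ?thesis using h \<open>0 \<le> D\<close> by (simp add: ennreal_mult')
      qed
      have "(\<integral>\<^sup>+t\<in>{0<..<\<epsilon>}. (ennreal_powr (weighted_rearrangement \<Omega> p \<kappa> f t) r / ennreal t) \<partial>lborel)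
        \<le> (\<integral>\<^sup>+t. ennreal D * (ennreal_powr (rearrangement \<Omega> f t) q * indicator {0<..} t) \<partial>lborel)"
        using point by (intro nn_integral_mono) (auto simp: indicator_def)
      also have "\<dots> = ennreal D * (\<integral>\<^sup>+t\<in>{0<..}. ennreal_powr (rearrangement \<Omega> f t) q \<partial>lborel)"
        using meas by (intro nn_integral_cmult) auto
      also have "\<dots> \<le> ennreal D * ennreal A"
        using nn_integral_rearrangement_powr_le[OF \<Omega> f q(2)] intA by (intro mult_left_mono) auto
      also have "\<dots> = ennreal ((b * A powr (1 / q)) powr r)"
      proof -
        \<comment> \<open>The exponents r - q and q recombine to r, so the outer power 1/r leaves a
          bound that no longer depends on \<open>r\<close>.\<close>
        have "D * A = b powr r * ((A powr (1 / q)) powr (r - q) * (A powr (1 / q)) powr q)"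
          using A q(2) by (simp add: D_def powr_powr)
        also have "\<dots> = (b * A powr (1 / q)) powr r"
          using A b(1) by (simp add: powr_mult flip: powr_add)
        finally show ?thesis using \<open>0 \<le> D\<close> A by (simp flip: ennreal_mult')
      qed
      finally have "ennreal_powr (\<integral>\<^sup>+t\<in>{0<..<\<epsilon>}. (ennreal_powr (weighted_rearrangement \<Omega> p \<kappa> f t) r / ennreal t) \<partial>lborel) (1 / r)
          \<le> ennreal_powr (ennreal ((b * A powr (1 / q)) powr r)) (1 / r)"
        using q(2) r by (intro ennreal_powr_mono) auto
      also have "\<dots> = ennreal (b * A powr (1 / q))"
        using q(2) r b(1) A by (simp add: powr_powr)
      finally show ?thesis by (simp add: rearrangement_functional_def r(1))
    qed
    also have "\<dots> = ennreal ?c * ennreal l"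
      using c l(1) by (simp add: Aq mult_ac flip: ennreal_mult')
    finally show "rearrangement_functional \<Omega> p \<kappa> \<epsilon> v f \<le> ennreal ?c * ennreal l" .
  qed
  with c show ?thesis unfolding rearrangement_inequality_def by blast
qed

section \<open>Test functions concentrated at the minimum point of the exponent\<close>

text \<open>The integral condition says that the indicator of \<open>B m\<close> has norm at most \<open>K m\<^bsup>1/q\<^esup>\<close>.\<close>

definition small_indicator_sets ::
    "'a::euclidean_space set \<Rightarrow> ('a \<Rightarrow> real) \<Rightarrow> real \<Rightarrow> real \<Rightarrow> real \<Rightarrow> (real \<Rightarrow> 'a set) \<Rightarrow> bool" where
  "small_indicator_sets \<Omega> p q K M B \<longleftrightarrow> 0 < K \<and> 0 < M \<and>
     (\<forall>m. 0 < m \<and> m \<le> M \<longrightarrow> B m \<in> sets (lebesgue_on \<Omega>) \<and> emeasure (lebesgue_on \<Omega>) (B m) = ennreal m \<and>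
       (\<integral>\<^sup>+x\<in>B m. ennreal ((1 / (K * m powr (1 / q))) powr p x) \<partial>lebesgue_on \<Omega>) \<le> 1)"

text \<open>Let R be the radius of the ball of measure m in dimension d. Then K m^(1/q) = L R^(d/q),
  and its power with exponent -p(x) factors into L^(-p(x)), R^(-d) and R^(-(d/q)(p(x)-q)). The last
  factor is at most exp(d C / q) by log-Hoelder continuity, R^(-d) is of order 1/m, and a large L
  brings the product below 1/m.\<close>

lemma small_indicator_sets_balls:
  fixes \<Omega> :: "'a::euclidean_space set"
  assumes "open \<Omega>" and q: "0 < q" "p x\<^sub>0 = q" and AEq: "AE x in lebesgue_on \<Omega>. q \<le> p x"
    and "log_Hoelder_at \<Omega> x\<^sub>0 p"
  shows "\<exists>K M B. small_indicator_sets \<Omega> p q K M B"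
proof -
  obtain C where C: "0 < C" and x\<^sub>0: "x\<^sub>0 \<in> \<Omega>"
    and H: "\<And>x. x \<in> \<Omega> \<Longrightarrow> norm (x - x\<^sub>0) < 1/2 \<Longrightarrow> \<bar>p x - q\<bar> \<le> C / (- ln (norm (x - x\<^sub>0)))"
    using assms(5) q(2) unfolding log_Hoelder_at_def by blast
  obtain r\<^sub>1 where r\<^sub>1: "0 < r\<^sub>1" "ball x\<^sub>0 r\<^sub>1 \<subseteq> \<Omega>"
    using \<open>open \<Omega>\<close> x\<^sub>0 openE by blast
  \<comment> \<open>Radii up to 1/2 stay in the range of the log-Hoelder condition and have negative
    logarithm.\<close>
  define r\<^sub>0 where "r\<^sub>0 = min r\<^sub>1 (1/2)"
  let ?d = "real DIM('a)"
  define \<omega> where "\<omega> = unit_ball_vol ?d"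
  have \<omega>: "0 < \<omega>" by (simp add: \<omega>_def)
  \<comment> \<open>L^q = E absorbs the constants \<omega> and exp(d C / q). The maximum with 1
    gives L \<ge> 1, so that q \<le> p(x) yields L^(-p(x)) \<le> 1/E.\<close>
  define E where "E = max 1 (\<omega> * exp (?d * C / q))"
  define L where "L = E powr (1 / q)"
  have L: "1 \<le> L" "L powr q = E" using q(1) by (auto simp: L_def E_def powr_powr ge_one_powr_ge_zero)
  define K where "K = L / \<omega> powr (1 / q)"
  define M where "M = \<omega> * r\<^sub>0 powr ?d"
  define R where "R m = (m / \<omega>) powr (1 / ?d)" for m
  have r\<^sub>0: "0 < r\<^sub>0" "r\<^sub>0 \<le> 1/2" "ball x\<^sub>0 r\<^sub>0 \<subseteq> \<Omega>" using r\<^sub>1 by (auto simp: r\<^sub>0_def)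
  have KM: "0 < K" "0 < M" using L \<omega> r\<^sub>0 by (auto simp: K_def M_def)
  have main: "ball x\<^sub>0 (R m) \<in> sets (lebesgue_on \<Omega>) \<and>
      emeasure (lebesgue_on \<Omega>) (ball x\<^sub>0 (R m)) = ennreal m \<and>
      (\<integral>\<^sup>+x\<in>ball x\<^sub>0 (R m). ennreal ((1 / (K * m powr (1 / q))) powr p x) \<partial>lebesgue_on \<Omega>) \<le> 1"
    if m: "0 < m" "m \<le> M" for m
  proof -
    have R: "0 < R m" "R m powr ?d = m / \<omega>"
      using m \<omega> by (auto simp: R_def powr_powr)
    have "R m \<le> (M / \<omega>) powr (1 / ?d)"
      unfolding R_def using m \<omega> by (intro powr_mono2 divide_right_mono) auto
    also have "\<dots> = r\<^sub>0" using \<omega> r\<^sub>0 by (simp add: M_def powr_powr)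
    finally have Rr: "R m \<le> r\<^sub>0" .
    then have sub: "ball x\<^sub>0 (R m) \<subseteq> \<Omega>" using r\<^sub>0(3) by (meson order_trans subset_ball)
    have sets: "ball x\<^sub>0 (R m) \<in> sets (lebesgue_on \<Omega>)"
      using sub \<open>open \<Omega>\<close> by (simp add: sets_restrict_space_iff)
    have em: "emeasure (lebesgue_on \<Omega>) (ball x\<^sub>0 (R m)) = ennreal m"
    proof -
      have "emeasure (lebesgue_on \<Omega>) (ball x\<^sub>0 (R m)) = emeasure lborel (ball x\<^sub>0 (R m))"
        using sub \<open>open \<Omega>\<close> by (simp add: emeasure_restrict_space)
      also have "\<dots> = ennreal (\<omega> * R m ^ DIM('a))"
        using R by (simp add: emeasure_ball \<omega>_def)
      also have "R m ^ DIM('a) = m / \<omega>" using R by (simp flip: powr_realpow)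
      finally show ?thesis using \<omega> by simp
    qed
    have lam: "K * m powr (1 / q) = L * R m powr (?d / q)"
    proof -
      have "R m powr (?d / q) = (R m powr ?d) powr (1 / q)" by (simp add: powr_powr)
      then show ?thesis using m \<omega> by (simp add: K_def R powr_divide)
    qed
    have bound: "(1 / (K * m powr (1 / q))) powr p x \<le> 1 / m"
      if x: "x \<in> ball x\<^sub>0 (R m)" and qp: "q \<le> p x" for x
    proof -
      have n: "norm (x - x\<^sub>0) < R m" using x by (simp add: dist_norm norm_minus_commute)
      have lnR: "ln (R m) < 0" using R Rr r\<^sub>0 by (simp add: ln_less_zero)
      have "p x - q \<le> C / (- ln (R m))"
      \<comment> \<open>At the centre the value ln 0 = 0 spoils the comparison of logarithms, but
        there p(x) - q vanishes.\<close>
      proof (cases "x = x\<^sub>0")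
        case True
        then show ?thesis using q C lnR by (simp add: divide_nonneg_neg divide_nonpos_neg)
      next
        case False
        then have "0 < norm (x - x\<^sub>0)" by simp
        then have "ln (norm (x - x\<^sub>0)) \<le> ln (R m)" using n R(1) by simp
        then have "C / (- ln (norm (x - x\<^sub>0))) \<le> C / (- ln (R m))"
          using C lnR by (intro divide_left_mono) (auto simp: mult_neg_neg)
        moreover have "\<bar>p x - q\<bar> \<le> C / (- ln (norm (x - x\<^sub>0)))"
          using H[of x] x sub n Rr r\<^sub>0 by auto
        ultimately show ?thesis by linarith
      qed
      then have "- ln (R m) * (p x - q) \<le> C"
        using lnR by (simp add: field_simps)
      then have "?d / q * (- ln (R m) * (p x - q)) \<le> ?d / q * C"
        using q by (intro mult_left_mono) auto
      then have e: "R m powr (- (?d / q) * (p x - q)) \<le> exp (?d * C / q)"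
        using R by (simp add: powr_def mult_ac)
      have "0 < L * R m powr (?d / q)" using L R by simp
      then have "(1 / (K * m powr (1 / q))) powr p x = (L * R m powr (?d / q)) powr (- p x)"
        unfolding lam by (simp only: powr_minus inverse_eq_divide powr_divide powr_one_eq_one)
      also have "\<dots> = L powr (- p x) * R m powr (- (?d / q) * p x)"
        using L R by (simp add: powr_mult powr_powr)
      \<comment> \<open>The summand -d is split off because R^(-d) = \<omega>/m carries the whole
        size of the estimate.\<close>
      also have "- (?d / q) * p x = - (?d / q) * (p x - q) + (- ?d)"
        using q by (simp add: field_simps)
      also have "R m powr (- (?d / q) * (p x - q) + (- ?d)) = R m powr (- (?d / q) * (p x - q)) * (\<omega> / m)"
      proof -
        have "R m powr (- ?d) = \<omega> / m" using R(2) by (simp add: powr_minus)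
        then show ?thesis by (simp only: powr_add)
      qed
      also have "L powr (- p x) * (R m powr (- (?d / q) * (p x - q)) * (\<omega> / m))
          \<le> (1 / (\<omega> * exp (?d * C / q))) * (exp (?d * C / q) * (\<omega> / m))"
      proof (intro mult_mono e order_refl)
        have "L powr (- p x) \<le> L powr (- q)" using L qp by (intro powr_mono) auto
        also have "\<dots> = 1 / E" using L by (simp add: powr_minus divide_inverse)
        also have "\<dots> \<le> 1 / (\<omega> * exp (?d * C / q))"
          using \<omega> by (intro divide_left_mono) (auto simp: E_def)
        finally show "L powr (- p x) \<le> 1 / (\<omega> * exp (?d * C / q))" .
      qed (use \<omega> m in auto)
      also have "\<dots> = 1 / m" using \<omega> by simp
      finally show ?thesis .
    qed
    have "(\<integral>\<^sup>+x\<in>ball x\<^sub>0 (R m). ennreal ((1 / (K * m powr (1 / q))) powr p x) \<partial>lebesgue_on \<Omega>)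
        \<le> (\<integral>\<^sup>+x. ennreal (1 / m) * indicator (ball x\<^sub>0 (R m)) x \<partial>lebesgue_on \<Omega>)"
      by (rule nn_integral_mono_AE, use AEq in eventually_elim)
        (use bound in \<open>auto simp: indicator_def intro!: ennreal_leI\<close>)
    also have "\<dots> = ennreal (1 / m) * ennreal m"
      using sets by (simp add: nn_integral_cmult_indicator em)
    also have "\<dots> = 1" using m by (simp flip: ennreal_mult')
    finally show ?thesis using sets em by blast
  qed
  then have "small_indicator_sets \<Omega> p q K M (\<lambda>m. ball x\<^sub>0 (R m))"
    unfolding small_indicator_sets_def using KM by simp
  then show ?thesis by blast
qed

text \<open>A maximum is used since at each point it equals one of its terms, so its power p(x) is
  dominated by the sum of the powers of the terms without an extra constant.\<close>

definition step_function :: "real \<Rightarrow> (real \<Rightarrow> 'a set) \<Rightarrow> real \<Rightarrow> nat \<Rightarrow> 'a \<Rightarrow> real" where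
  "step_function q B m N x = Max ((\<lambda>k. 2 powr (k / q) * indicator (B (m / 2 ^ k)) x) ` {..<N})"

text \<open>Dividing by the additional factor N^(1/q) multiplies each term of the modular by
  N^(-p(x)/q) \<le> 1/N, so the N terms together contribute at most 1. The lower bound holds because
  f \<ge> 2^(k/q) on a set of measure m/2^k > t.\<close>

lemma step_function:
  fixes \<Omega> :: "'a::euclidean_space set" and N :: nat
  assumes B: "small_indicator_sets \<Omega> p q K M B" and q: "0 < q"
    and AEq: "AE x in lebesgue_on \<Omega>. q \<le> p x" and p [measurable]: "p \<in> borel_measurable (lebesgue_on \<Omega>)"
    and m: "0 < m" "m \<le> M" and N: "0 < N"
  defines "f \<equiv> step_function q B m N"
  shows "f \<in> var_Lebesgue \<Omega> p"
    and "var_norm \<Omega> p f \<le> ennreal (K * m powr (1 / q) * N powr (1 / q))"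
    and "\<And>k t. k < N \<Longrightarrow> t < m / 2 ^ k \<Longrightarrow> ennreal (2 powr (k / q)) \<le> rearrangement \<Omega> f t"
proof -
  have mk: "0 < m / 2 ^ k \<and> m / 2 ^ k \<le> M" for k :: nat
  proof -
    have "m / 2 ^ k \<le> m / 1" using m by (intro divide_left_mono) auto
    then show ?thesis using m by auto
  qed
  have K: "0 < K" using B by (simp add: small_indicator_sets_def)
  have Bk [measurable]: "B (m / 2 ^ k) \<in> sets (lebesgue_on \<Omega>)"
    and emB: "emeasure (lebesgue_on \<Omega>) (B (m / 2 ^ k)) = ennreal (m / 2 ^ k)"
    and intB: "(\<integral>\<^sup>+x\<in>B (m / 2 ^ k). ennreal ((1 / (K * (m / 2 ^ k) powr (1 / q))) powr p x) \<partial>lebesgue_on \<Omega>) \<le> 1"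
    for k :: nat
    using B mk[of k] unfolding small_indicator_sets_def by blast+
  have f [measurable]: "f \<in> borel_measurable (lebesgue_on \<Omega>)"
    unfolding f_def step_function_def by measurable
  let ?l = "K * m powr (1 / q) * N powr (1 / q)"
  have l: "0 < ?l" using K m N by simp
  have ne: "(\<lambda>k. 2 powr (k / q) * indicator (B (m / 2 ^ k)) x) ` {..<N} \<noteq> {}" for x
    using N by auto
  have fval: "\<exists>k<N. f x = 2 powr (k / q) * indicator (B (m / 2 ^ k)) x" for x
    using Max_in[OF _ ne[of x]] unfolding f_def step_function_def by auto
  have fge: "2 powr (k / q) * indicator (B (m / 2 ^ k)) x \<le> f x" if "k < N" for k x
    unfolding f_def step_function_def using that by (intro Max_ge) auto
  \<comment> \<open>The height 2^(k/q) exactly compensates the shrinking measure m/2^k, so all N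
    pieces obey the same norm bound.\<close>
  have scale: "2 powr (k / q) / ?l = N powr (- 1 / q) * (1 / (K * (m / 2 ^ k) powr (1 / q)))" for k :: nat
  proof -
    have "(m / 2 ^ k) powr (1 / q) = m powr (1 / q) / 2 powr (k / q)"
      unfolding powr_divide by (simp add: powr_powr flip: powr_realpow)
    moreover have "N powr (- 1 / q) = 1 / N powr (1 / q)"
      by (simp add: powr_minus_divide)
    ultimately show ?thesis by simp
  qed
  let ?g = "\<lambda>k x. ennreal ((1 / (K * (m / 2 ^ k) powr (1 / q))) powr p x) * indicator (B (m / 2 ^ k)) x"
  have "var_modular \<Omega> p (\<lambda>x. f x / ?l) \<le> (\<integral>\<^sup>+x. (\<Sum>k<N. ennreal (1 / N) * ?g k x) \<partial>lebesgue_on \<Omega>)"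
    unfolding var_modular_def
  proof (rule nn_integral_mono_AE, use AEq in eventually_elim)
    fix x assume px: "q \<le> p x"
    obtain k where k: "k < N" "f x = 2 powr (k / q) * indicator (B (m / 2 ^ k)) x"
      using fval by blast
    have "ennreal (\<bar>f x / ?l\<bar> powr p x) \<le> ennreal (1 / N) * ?g k x"
    proof (cases "x \<in> B (m / 2 ^ k)")
      case True
      define h where "h = 1 / (K * (m / 2 ^ k) powr (1 / q))"
      have h: "0 \<le> h" using K by (simp add: h_def)
      have "\<bar>f x / ?l\<bar> = N powr (- 1 / q) * h"
        using True k scale[of k, folded h_def] l h by simp
      then have "\<bar>f x / ?l\<bar> powr p x = N powr (- (p x / q)) * h powr p x"
        using h by (simp add: powr_mult powr_powr)
      also have "N powr (- (p x / q)) \<le> N powr (- 1)"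
        using N px q by (intro powr_mono) auto
      then have "N powr (- (p x / q)) * h powr p x \<le> 1 / N * h powr p x"
        using N by (intro mult_right_mono) (auto simp: powr_minus_divide)
      finally have "ennreal (\<bar>f x / ?l\<bar> powr p x) \<le> ennreal (1 / N * h powr p x)"
        by (rule ennreal_leI)
      also have "\<dots> = ennreal (1 / N) * ennreal (h powr p x)"
        by (rule ennreal_mult') simp
      finally show ?thesis using True by (simp add: h_def)
    qed (use k in simp)
    also have "\<dots> \<le> (\<Sum>k<N. ennreal (1 / N) * ?g k x)"
      using k by (intro member_le_sum) auto
    finally show "ennreal (\<bar>f x / ?l\<bar> powr p x) \<le> (\<Sum>k<N. ennreal (1 / N) * ?g k x)" .
  qed
  also have "\<dots> = (\<Sum>k<N. ennreal (1 / N) * (\<integral>\<^sup>+x. ?g k x \<partial>lebesgue_on \<Omega>))"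
    by (subst nn_integral_sum) (auto intro!: sum.cong nn_integral_cmult)
  also have "\<dots> \<le> (\<Sum>k<N. ennreal (1 / N) * 1)"
    by (intro sum_mono mult_left_mono intB) auto
  also have "\<dots> = 1"
    using N by (simp add: ennreal_of_nat_eq_real_of_nat flip: ennreal_mult')
  finally have mod: "var_modular \<Omega> p (\<lambda>x. f x / ?l) \<le> 1" .
  then have "var_modular \<Omega> p (\<lambda>x. f x / ?l) < \<infinity>"
    by (rule le_less_trans) simp
  with l show "f \<in> var_Lebesgue \<Omega> p"
    unfolding var_Lebesgue_def using f by blast
  show "var_norm \<Omega> p f \<le> ennreal ?l"
    unfolding var_norm_def using l mod by (intro INF_lower) auto
  fix k :: nat and t :: real
  assume k: "k < N" and t: "t < m / 2 ^ k"
  show "ennreal (2 powr (k / q)) \<le> rearrangement \<Omega> f t"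
  proof (rule le_rearrangement[OF Bk[of k] _ _ f])
    show "2 powr (k / q) \<le> \<bar>f x\<bar>" if "x \<in> B (m / 2 ^ k)" for x
      using fge[OF k, of x] that by simp
    show "ennreal t < emeasure (lebesgue_on \<Omega>) (B (m / 2 ^ k))"
      using t mk[of k] by (simp add: emB ennreal_lessI)
  qed
qed

section \<open>Necessity via dyadic intervals\<close>

text \<open>The dyadic intervals are pairwise disjoint, so at most one term is nonzero at
  \<open>t\<close>. Separate lower bounds on the intervals thus combine into one minorant to be
  integrated.\<close>

lemma sum_indicator_dyadic_le:
  fixes c :: "nat \<Rightarrow> ennreal" and m :: real
  assumes m: "0 < m" and le: "\<And>k. k < N \<Longrightarrow> t \<in> {m / 2 ^ Suc k<..<m / 2 ^ k} \<Longrightarrow> c k \<le> G"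
  shows "(\<Sum>k<N. c k * indicator {m / 2 ^ Suc k<..<m / 2 ^ k} t) \<le> G"
proof (cases "\<exists>k<N. t \<in> {m / 2 ^ Suc k<..<m / 2 ^ k}")
  case True
  then obtain k where k: "k < N" "t \<in> {m / 2 ^ Suc k<..<m / 2 ^ k}" by blast
  have disj: False if "i < j" "t \<in> {m / 2 ^ Suc i<..<m / 2 ^ i}" "t \<in> {m / 2 ^ Suc j<..<m / 2 ^ j}" for i j
  proof -
    have "m / 2 ^ j \<le> m / 2 ^ Suc i"
      using m that(1) by (intro divide_left_mono power_increasing) auto
    with that show False by auto
  qed
  have "t \<notin> {m / 2 ^ Suc j<..<m / 2 ^ j}" if "j \<noteq> k" for j
    using disj[of j k] disj[of k j] k(2) that by (meson linorder_neqE_nat)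
  then have "(\<Sum>k<N. c k * indicator {m / 2 ^ Suc k<..<m / 2 ^ k} t) = (\<Sum>j<N. if j = k then c k else 0)"
    using k(2) by (intro sum.cong) (auto simp: indicator_def)
  also have "\<dots> = c k" using k by simp
  also have "\<dots> \<le> G" using k le by blast
  finally show ?thesis .
next
  case False
  then have "(\<Sum>k<N. c k * indicator {m / 2 ^ Suc k<..<m / 2 ^ k} t) = 0"
    by (intro sum.neutral) auto
  then show ?thesis by simp
qed

text \<open>On the k-th dyadic interval t > m/2^(k+1), the rearrangement of the step function is at
  least 2^(k/q), and \<open>\<kappa> t\<close> is at least \<open>\<kappa> m\<close>. Hence the
  weighted rearrangement is at least \<open>y\<close>, and since 1/t \<ge> 2^k/m on an interval of
  length m/2^(k+1), each of the N intervals contributes at least y^r / 2. The halving in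
  \<open>y\<close> accounts for 2^(1/q), the halved contribution for 2^(1/r).\<close>

lemma rearrangement_inequality_necessary:
  fixes \<Omega> :: "'a::euclidean_space set" and N :: nat
  assumes B: "small_indicator_sets \<Omega> p q K M B" and q: "0 < q" "exponent_minus \<Omega> p = ereal q"
    and p: "p \<in> borel_measurable (lebesgue_on \<Omega>)"
    and \<epsilon>: "\<epsilon> \<le> M" and \<kappa>: "\<And>t. t \<in> {0<..\<epsilon>} \<Longrightarrow> 0 < \<kappa> t" "antimono_on {0<..\<epsilon>} \<kappa>"
    and r: "0 < r" and c: "0 < c"
    and ineq: "\<And>f. f \<in> var_Lebesgue \<Omega> p \<Longrightarrow>
      rearrangement_functional \<Omega> p \<kappa> \<epsilon> (ereal r) f \<le> ennreal c * var_norm \<Omega> p f"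
    and m: "m \<in> {0<..\<epsilon>}" and N: "0 < N"
  shows "\<kappa> m * N powr (1 / r - 1 / q) \<le> c * K * 2 powr (1 / q + 1 / r)"
proof -
  have AEq: "AE x in lebesgue_on \<Omega>. q \<le> p x"
    using AE_essinf_le[of "lebesgue_on \<Omega>" "\<lambda>x. ereal (p x)"] q(2) unfolding exponent_minus_def by simp
  have K: "0 < K" using B by (simp add: small_indicator_sets_def)
  define f where "f = step_function q B m N"
  have m': "0 < m" "m \<le> \<epsilon>" "m \<le> M" using m \<epsilon> by auto
  note sf = step_function[OF B q(1) AEq p m'(1,3) N, folded f_def]
  define y where "y = \<kappa> m * (m / 2) powr (1 / q)"
  have y: "0 < y" using \<kappa>(1)[OF m] m' by (simp add: y_def)
  let ?G = "\<lambda>t. ennreal_powr (weighted_rearrangement \<Omega> p \<kappa> f t) r / ennreal t"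
  let ?c = "\<lambda>k::nat. ennreal (y powr r / (m / 2 ^ k))"
  let ?I = "\<lambda>k::nat. {m / 2 ^ Suc k<..<m / 2 ^ k}"
  have G: "?c k \<le> ?G t * indicator {0<..<\<epsilon>} t" if k: "k < N" and t: "t \<in> ?I k" for k t
  proof -
    have "m / 2 ^ k \<le> m / 1" using m' by (intro divide_left_mono) auto
    moreover have "0 < m / 2 ^ Suc k" using m' by simp
    ultimately have tm: "0 < t" "t < m" "t < m / 2 ^ k" "m / 2 ^ Suc k < t"
      using t by (auto simp del: power_Suc)
    have "\<kappa> m \<le> \<kappa> t"
      using \<kappa>(2) m m' tm by (auto simp: monotone_on_def)
    have "(m / 2) powr (1 / q) = (m / 2 ^ Suc k) powr (1 / q) * 2 powr (k / q)"
      using m' by (simp add: powr_divide powr_powr powr_add powr_mult flip: powr_realpow)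
    also have "\<dots> \<le> t powr (1 / q) * 2 powr (k / q)"
      using tm m' q(1) by (intro mult_right_mono powr_mono2) auto
    finally have "y \<le> \<kappa> t * (t powr (1 / q) * 2 powr (k / q))"
      unfolding y_def using \<open>\<kappa> m \<le> \<kappa> t\<close> \<kappa>(1)[OF m] by (intro mult_mono) auto
    then have "ennreal y \<le> ennreal (\<kappa> t * (t powr (1 / q) * 2 powr (k / q)))"
      by (rule ennreal_leI)
    also have "\<dots> = ennreal (\<kappa> t) * ennreal (t powr (1 / q)) * ennreal (2 powr (k / q))"
      using \<open>\<kappa> m \<le> \<kappa> t\<close> \<kappa>(1)[OF m] by (simp add: ennreal_mult' ennreal_mult mult.assoc)
    also have "\<dots> \<le> weighted_rearrangement \<Omega> p \<kappa> f t"
      unfolding weighted_rearrangement_def using sf(3)[OF k tm(3)] q(2) by (auto intro!: mult_left_mono)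
    finally have "ennreal_powr (ennreal y) r \<le> ennreal_powr (weighted_rearrangement \<Omega> p \<kappa> f t) r"
      using r by (intro ennreal_powr_mono) auto
    then have "ennreal (y powr r) / ennreal t \<le> ?G t"
      using y by (intro divide_right_mono_ennreal) simp
    moreover have "ennreal (y powr r) / ennreal t = ennreal (y powr r / t)"
      using tm by (simp add: divide_ennreal)
    moreover have "?c k \<le> ennreal (y powr r / t)"
      using tm m' by (intro ennreal_leI divide_left_mono) auto
    moreover have "t \<in> {0<..<\<epsilon>}" using tm m' by simp
    ultimately show ?thesis
      by (simp only: indicator_simps mult_1_right)
  qed
  have "ennreal (y powr r * (N / 2)) = (\<Sum>k<N. ennreal (y powr r / 2))"
    using m' by (simp add: ennreal_of_nat_eq_real_of_nat flip: ennreal_mult')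
  also have "\<dots> = (\<Sum>k<N. ?c k * emeasure lborel (?I k))"
  proof (rule sum.cong)
    fix k
    have "m / 2 ^ Suc k \<le> m / 2 ^ k" using m' by (intro divide_left_mono) auto
    then have "emeasure lborel (?I k) = ennreal (m / 2 ^ k - m / 2 ^ Suc k)"
      by (simp del: power_Suc)
    moreover have "?c k * ennreal (m / 2 ^ k - m / 2 ^ Suc k) =
        ennreal (y powr r / (m / 2 ^ k) * (m / 2 ^ k - m / 2 ^ Suc k))"
      by (rule ennreal_mult'[symmetric]) (use m' in simp)
    moreover have "y powr r / (m / 2 ^ k) * (m / 2 ^ k - m / 2 ^ Suc k) = y powr r / 2"
      using m' by simp
    ultimately have "?c k * emeasure lborel (?I k) = ennreal (y powr r / 2)" by (simp only:)
    then show "ennreal (y powr r / 2) = ?c k * emeasure lborel (?I k)" ..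
  qed simp
  also have "\<dots> = (\<integral>\<^sup>+t. (\<Sum>k<N. ?c k * indicator (?I k) t) \<partial>lborel)"
    by (subst nn_integral_sum) (auto simp: nn_integral_cmult_indicator simp del: power_Suc)
  also have "\<dots> \<le> (\<integral>\<^sup>+t\<in>{0<..<\<epsilon>}. ?G t \<partial>lborel)"
    by (rule nn_integral_mono, rule sum_indicator_dyadic_le[OF m'(1) G])
  finally have "ennreal_powr (ennreal (y powr r * (N / 2))) (1 / r) \<le> ennreal_powr (\<integral>\<^sup>+t\<in>{0<..<\<epsilon>}. ?G t \<partial>lborel) (1 / r)"
    using r by (intro ennreal_powr_mono) auto
  also have "\<dots> = rearrangement_functional \<Omega> p \<kappa> \<epsilon> (ereal r) f"
    by (simp add: rearrangement_functional_def)
  also have "\<dots> \<le> ennreal c * var_norm \<Omega> p f" by (rule ineq[OF sf(1)])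
  also have "\<dots> \<le> ennreal c * ennreal (K * m powr (1 / q) * N powr (1 / q))"
    by (rule mult_left_mono[OF sf(2)]) simp
  finally have "(y powr r * (N / 2)) powr (1 / r) \<le> c * (K * m powr (1 / q) * N powr (1 / q))"
    using c K by (simp flip: ennreal_mult')
  moreover have "(y powr r * (N / 2)) powr (1 / r) = y * (N / 2) powr (1 / r)"
    unfolding powr_mult using r y by (simp add: powr_powr)
  moreover have "y * (N / 2) powr (1 / r) =
      \<kappa> m * N powr (1 / r - 1 / q) * (m powr (1 / q) * N powr (1 / q)) / 2 powr (1 / q + 1 / r)"
    unfolding y_def powr_divide powr_add powr_diff using N by simp
  ultimately have "\<kappa> m * N powr (1 / r - 1 / q) * (m powr (1 / q) * N powr (1 / q))
      \<le> c * K * 2 powr (1 / q + 1 / r) * (m powr (1 / q) * N powr (1 / q))"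
    by (simp add: pos_divide_le_eq mult_ac)
  then show ?thesis using m' N by (simp add: mult_le_cancel_right)
qed

section \<open>The equivalence for small \<open>\<epsilon>\<close>\<close>

theorem corollary7p3:
  fixes \<Omega> :: "'a::euclidean_space set" and p :: "'a \<Rightarrow> real"
  assumes "open \<Omega>" and "emeasure lebesgue \<Omega> < \<infinity>"
    and "p \<in> exponent_functions \<Omega>"
    and "1 < exponent_minus \<Omega> p"
    and "exponent_minus \<Omega> p \<le> exponent_plus \<Omega> p"
    and "exponent_plus \<Omega> p < \<infinity>"
    and "\<exists>x\<^sub>0\<in>\<Omega>. ereal (p x\<^sub>0) = exponent_minus \<Omega> p \<and> log_Hoelder_at \<Omega> x\<^sub>0 p"
  shows "\<exists>\<epsilon>\<^sub>0::real. 0 < \<epsilon>\<^sub>0 \<and> (\<forall>\<epsilon>::real. 0 < \<epsilon> \<and> \<epsilon> \<le> \<epsilon>\<^sub>0 \<longrightarrow>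
      (\<forall>(\<kappa>::real \<Rightarrow> real) (v::ereal).
         (\<forall>t\<in>{0<..\<epsilon>}. 0 < \<kappa> t) \<and> antimono_on {0<..\<epsilon>} \<kappa> \<and> 0 < v \<longrightarrow>
         (rearrangement_inequality \<Omega> p \<kappa> \<epsilon> v
            \<longleftrightarrow> bounded (\<kappa> ` {0<..\<epsilon>}) \<and> exponent_minus \<Omega> p \<le> v)) \<and>
      (\<forall>\<kappa>::real \<Rightarrow> real.
         (\<forall>t\<in>{0<..\<epsilon>}. 0 \<le> \<kappa> t) \<longrightarrow>
         (rearrangement_inequality \<Omega> p \<kappa> \<epsilon> \<infinity> \<longleftrightarrow> bounded (\<kappa> ` {0<..\<epsilon>}))))"
proof -
  have \<Omega>: "\<Omega> \<in> lmeasurable"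
    using assms(1,2) by (intro fmeasurableI) auto
  have p: "p \<in> borel_measurable (lebesgue_on \<Omega>)"
    using assms(3) by (simp add: exponent_functions_def)
  obtain x\<^sub>0 where x\<^sub>0: "ereal (p x\<^sub>0) = exponent_minus \<Omega> p" "log_Hoelder_at \<Omega> x\<^sub>0 p"
    using assms(7) by blast
  define q where "q = p x\<^sub>0"
  have q: "exponent_minus \<Omega> p = ereal q" "0 < q"
    using x\<^sub>0 assms(4) by (auto simp: q_def simp flip: x\<^sub>0(1))
  have AEq: "AE x in lebesgue_on \<Omega>. q \<le> p x"
    using AE_essinf_le[of "lebesgue_on \<Omega>" "\<lambda>x. ereal (p x)"] q(1) unfolding exponent_minus_def by simp
  obtain K M B where B: "small_indicator_sets \<Omega> p q K M B"
    using small_indicator_sets_balls[OF assms(1) q(2) q_def[symmetric] AEq x\<^sub>0(2)] by blast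
  then have KM: "0 < K" "0 < M" by (auto simp: small_indicator_sets_def)
  have sufficient: "rearrangement_inequality \<Omega> p \<kappa> \<epsilon> v"
    if bd: "bounded (\<kappa> ` {0<..\<epsilon>})" and v: "ereal q \<le> v" for \<kappa> \<epsilon> v
  proof -
    obtain b where b: "0 < b" "\<forall>y\<in>\<kappa> ` {0<..\<epsilon>}. norm y \<le> b"
      using bd bounded_pos by blast
    show ?thesis
      by (rule rearrangement_inequality_if_bounded[OF \<Omega> p q v b(1)])
        (use b(2) in \<open>force simp: abs_le_iff\<close>)
  qed
  have sup_necessary: "bounded (\<kappa> ` {0<..\<epsilon>})"
    if \<epsilon>: "\<epsilon> \<le> M / 2" and \<kappa>: "\<And>t. t \<in> {0<..\<epsilon>} \<Longrightarrow> 0 \<le> \<kappa> t"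
      and ineq: "rearrangement_inequality \<Omega> p \<kappa> \<epsilon> \<infinity>" for \<kappa> \<epsilon>
  proof -
    obtain c where c: "0 < c" "\<And>f. f \<in> var_Lebesgue \<Omega> p \<Longrightarrow>
        rearrangement_functional \<Omega> p \<kappa> \<epsilon> \<infinity> f \<le> ennreal c * var_norm \<Omega> p f"
      using ineq unfolding rearrangement_inequality_def by blast
    have bd: "\<kappa> t \<le> c * K * 2 powr (1 / q)" if t: "t \<in> {0<..<\<epsilon>}" for t
    proof -
      have t': "0 < 2 * t" "2 * t \<le> M" "0 \<le> \<kappa> t" using t \<epsilon> \<kappa>[of t] by auto
      \<comment> \<open>As \<open>\<kappa>\<close> need not be monotone here, each \<open>t\<close>
        gets its own indicator. Its set has measure 2t, since a measure strictly above
        \<open>t\<close> is what forces the rearrangement at \<open>t\<close> to be at least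
        1.\<close>
      define f where "f = step_function q B (2 * t) 1"
      note sf = step_function[OF B q(2) AEq p t'(1,2) zero_less_one, folded f_def]
      have "ennreal (\<kappa> t * t powr (1 / q)) = ennreal (\<kappa> t) * ennreal (t powr (1 / q)) * 1"
        using t' by (simp add: ennreal_mult')
      also have "\<dots> \<le> weighted_rearrangement \<Omega> p \<kappa> f t"
      proof -
        have "1 \<le> rearrangement \<Omega> f t" using sf(3)[of 0 t] t' by simp
        then show ?thesis
          unfolding weighted_rearrangement_def q(1) real_of_ereal.simps by (rule mult_left_mono) simp
      qed
      also have "\<dots> \<le> rearrangement_functional \<Omega> p \<kappa> \<epsilon> \<infinity> f"
        unfolding rearrangement_functional_def using t by (auto intro!: SUP_upper)
      also have "\<dots> \<le> ennreal c * var_norm \<Omega> p f" by (rule c(2)[OF sf(1)])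
      also have "\<dots> \<le> ennreal c * ennreal (K * (2 * t) powr (1 / q) * real 1 powr (1 / q))"
        by (rule mult_left_mono[OF sf(2)]) simp
      finally have "\<kappa> t * t powr (1 / q) \<le> c * K * 2 powr (1 / q) * t powr (1 / q)"
        using c KM t' by (simp add: powr_mult mult_ac flip: ennreal_mult')
      then show ?thesis using t' by (simp add: mult_le_cancel_right)
    qed
    show ?thesis
      unfolding bounded_iff
    proof (intro exI ballI, clarify)
      fix t assume t: "t \<in> {0<..\<epsilon>}"
      \<comment> \<open>The supremum runs over t < \<open>\<epsilon>\<close> and carries no
        information on \<open>\<kappa> \<epsilon>\<close>, which enters the bound as a single extra
        value.\<close>
      show "norm (\<kappa> t) \<le> max (\<kappa> \<epsilon>) (c * K * 2 powr (1 / q))"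
        using bd[of t] \<kappa>[OF t] t by (cases "t = \<epsilon>") auto
    qed
  qed
  have necessary: "bounded (\<kappa> ` {0<..\<epsilon>}) \<and> ereal q \<le> v"
    if \<epsilon>: "0 < \<epsilon>" "\<epsilon> \<le> M / 2" and \<kappa>: "\<And>t. t \<in> {0<..\<epsilon>} \<Longrightarrow> 0 < \<kappa> t" "antimono_on {0<..\<epsilon>} \<kappa>"
      and v: "0 < v" and ineq: "rearrangement_inequality \<Omega> p \<kappa> \<epsilon> v" for \<kappa> \<epsilon> v
  proof (cases "v = \<infinity>")
    case True
    then show ?thesis using sup_necessary[of \<epsilon> \<kappa>] \<epsilon> \<kappa>(1) ineq by (auto intro: less_imp_le)
  next
    case False
    then obtain r where r: "v = ereal r" "0 < r" using v by (cases v) auto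
    obtain c where c: "0 < c" "\<And>f. f \<in> var_Lebesgue \<Omega> p \<Longrightarrow>
        rearrangement_functional \<Omega> p \<kappa> \<epsilon> (ereal r) f \<le> ennreal c * var_norm \<Omega> p f"
      using ineq unfolding rearrangement_inequality_def r(1) by blast
    define D where "D = c * K * 2 powr (1 / q + 1 / r)"
    have main: "\<kappa> m * N powr (1 / r - 1 / q) \<le> D" if "m \<in> {0<..\<epsilon>}" "0 < N" for m and N :: nat
      unfolding D_def
      by (rule rearrangement_inequality_necessary[OF B q(2,1) p _ \<kappa> r(2) c that]) (use \<epsilon> in auto)
    have "bounded (\<kappa> ` {0<..\<epsilon>})"
      unfolding bounded_iff
    proof (intro exI ballI, clarify)
      fix t assume t: "t \<in> {0<..\<epsilon>}"
      show "norm (\<kappa> t) \<le> D" using main[OF t, of 1] \<kappa>(1)[OF t] by simp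
    qed
    moreover have "q \<le> r"
    proof (rule ccontr)
      assume "\<not> q \<le> r"
      define a where "a = 1 / r - 1 / q"
      have "0 < a" using \<open>\<not> q \<le> r\<close> r q by (simp add: a_def field_simps)
      \<comment> \<open>For r < q the exponent \<open>a\<close> is positive, and any N above
        D'^(1/a) makes N^a exceed D / \<open>\<kappa> \<epsilon>\<close>, contradicting
        \<open>main\<close> at m = \<open>\<epsilon>\<close>. The maximum with 1 makes the base
        \<open>D'\<close> visibly positive.\<close>
      define D' where "D' = max 1 (D / \<kappa> \<epsilon>)"
      obtain N :: nat where DN: "D' powr (1 / a) < N"
        using reals_Archimedean2 by blast
      have "0 < D'" by (simp add: D'_def less_max_iff_disj)
      then have "0 < D' powr (1 / a)" by simp
      with DN have "0 < real N" by linarith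
      moreover have "(D' powr (1 / a)) powr a < N powr a"
        using \<open>0 < a\<close> DN by (intro powr_less_mono2) auto
      ultimately have N: "D / \<kappa> \<epsilon> < N powr (1 / r - 1 / q)" "0 < N"
        using \<open>0 < a\<close> by (auto simp: powr_powr D'_def simp flip: a_def)
      have "\<epsilon> \<in> {0<..\<epsilon>}" using \<epsilon> by simp
      then show False using main[of \<epsilon> N] N \<kappa>(1)[of \<epsilon>] by (simp add: field_simps)
    qed
    ultimately show ?thesis using r by simp
  qed
  show ?thesis
  \<comment> \<open>\<open>M\<close> was fixed before \<open>\<kappa>\<close> and \<open>v\<close>.
    The half leaves room for the sets of measure 2t in \<open>sup_necessary\<close>.\<close>
  proof (intro exI[of _ "M / 2"] conjI allI impI)
    show "0 < M / 2" using KM by simp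
  next
    fix \<epsilon> and \<kappa> :: "real \<Rightarrow> real" and v :: ereal
    assume "0 < \<epsilon> \<and> \<epsilon> \<le> M / 2"
      and "(\<forall>t\<in>{0<..\<epsilon>}. 0 < \<kappa> t) \<and> antimono_on {0<..\<epsilon>} \<kappa> \<and> 0 < v"
    then show "rearrangement_inequality \<Omega> p \<kappa> \<epsilon> v
        \<longleftrightarrow> bounded (\<kappa> ` {0<..\<epsilon>}) \<and> exponent_minus \<Omega> p \<le> v"
      using necessary[of \<epsilon> \<kappa> v] sufficient[of \<kappa> \<epsilon> v] q(1) by auto
  next
    fix \<epsilon> and \<kappa> :: "real \<Rightarrow> real"
    assume "0 < \<epsilon> \<and> \<epsilon> \<le> M / 2" and "\<forall>t\<in>{0<..\<epsilon>}. 0 \<le> \<kappa> t"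
    then show "rearrangement_inequality \<Omega> p \<kappa> \<epsilon> \<infinity> \<longleftrightarrow> bounded (\<kappa> ` {0<..\<epsilon>})"
      using sup_necessary[of \<epsilon> \<kappa>] sufficient[of \<kappa> \<epsilon> \<infinity>] by auto
  qed
qed

end
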